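(* Let $\nu$ be a finite Borel measure on $\mathcal{Q}$ with $\nu(\mathcal{Q})>0$, and for $s>0$ consider $\mathfrak{J}_s:\mathcal{D}\to\mathbb{R}_{\ge0}$, $Q\mapsto(\nu(Q))^s$. Suppose $\dim_\infty(\mathfrak{J}_1)>0$. Then for every $s>0$, $$\underline{h}_{\mathfrak{J}_s}=\overline{h}_{\mathfrak{J}_s}=\mathfrak{q}_{\mathfrak{J}_s}=1/s.$$
   Context: Dyadic cubes. Let $d\in\mathbb{N}$. A dyadic cube of side length $2^{-n}$ is a product $I_1\times\cdots\times I_d$ of intervals of length $2^{-n}$ (each half-open, open, or closed) with endpoints in $\{k2^{-n}:k\in\mathbb{Z}\}$. Fix a dyadic unit cube $\mathcal{Q}\subset\mathbb{R}^d$ and partitions $\mathcal{D}_n$ of $\mathcal{Q}$ into dyadic cubes of side length $2^{-n}$ with $\mathcal{D}_0=\{\mathcal{Q}\}$ and such that each element of $\mathcal{D}_n$ is the disjoint union of exactly $2^d$ elements of $\mathcal{D}_{n+1}$. Put $\mathcal{D}=\bigcup_{n\ge0}\mathcal{D}_n$. Definitions, for $\mathfrak{J}:\mathcal{D}\to\mathbb{R}_{\ge0}$ monotone and not identically zero. For $x>1/\mathfrak{J}(\mathcal{Q})$, $$G_x=\{Q\in\mathcal{D}:\mathfrak{J}(Q)<1/x\text{ and, if }Q\in\mathcal{D}_n,\ \exists Q'\in\mathcal{D}_{n-1}\text{ with }Q'\supset Q,\ \mathfrak{J}(Q')\ge1/x\},$$ $M(x)=\operatorname{card}(G_x)$, $\overline{h}_{\mathfrak{J}}=\limsup_{x\to\infty}\frac{\log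 M(x)}{\log x}$, $\underline{h}_{\mathfrak{J}}=\liminf_{x\to\infty}\frac{\log M(x)}{\log x}$. For $q\ge0$, $\tau_{\mathfrak{J}}(q)=\limsup_{n\to\infty}\frac{1}{\log 2^n}\log\sum_{Q\in\mathcal{D}_n}\mathfrak{J}(Q)^q$ (with $0^0=0$), $\mathfrak{q}_{\mathfrak{J}}=\inf\{q\ge0:\tau_{\mathfrak{J}}(q)<0\}$, and $\dim_\infty(\mathfrak{J})=\liminf_{n\to\infty}\frac{\log\max_{Q\in\mathcal{D}_n}\mathfrak{J}(Q)}{-\log 2^n}$. *)

theory Defs
  imports "HOL-Analysis.Analysis" "HOL-Library.Disjoint_Sets"
begin

definition dyadic_interval :: "nat \<Rightarrow> real set \<Rightarrow> bool" where
  "dyadic_interval n I \<longleftrightarrow>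
     (\<exists>k::int. let a = of_int k / 2 ^ n; b = (of_int k + 1) / 2 ^ n in
        I = {a<..<b} \<or> I = {a..<b} \<or> I = {a<..b} \<or> I = {a..b})"

definition dyadic_cube :: "nat \<Rightarrow> (real ^ 'd) set \<Rightarrow> bool" where
  "dyadic_cube n C \<longleftrightarrow>
     (\<exists>I. (\<forall>i. dyadic_interval n (I i)) \<and> C = {x. \<forall>i. x $ i \<in> I i})"

definition dyadic_partitions :: "(real ^ 'd) set \<Rightarrow> (nat \<Rightarrow> (real ^ 'd) set set) \<Rightarrow> bool" where
  "dyadic_partitions Q D \<longleftrightarrow>
     dyadic_cube 0 Q \<and> D 0 = {Q} \<and>
     (\<forall>n. partition_on Q (D n) \<and> (\<forall>C \<in> D n. dyadic_cube n C)) \<and>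
     (\<forall>n. \<forall>C \<in> D n. \<exists>S \<subseteq> D (Suc n). card S = 2 ^ CARD('d) \<and> partition_on C S)"

text \<open>
  Logarithm with values in the extended reals, so that \<open>log 0 = -\<infinity>\<close>
  (whereas \<open>ln 0 = 0\<close> on \<open>real\<close>) and \<open>log \<infinity> = \<infinity>\<close>. The value at negative
  arguments is immaterial.
\<close>
definition eln :: "ereal \<Rightarrow> ereal" where
  "eln x = (if x \<le> 0 then -\<infinity> else if x = \<infinity> then \<infinity> else ereal (ln (real_of_ereal x)))"

text \<open>
  In the rest of the theory \<open>D n\<close> is the set of cubes of side length \<open>2\<^sup>-\<^sup>n\<close> and \<open>J\<close> a
  set function, of which only the values on \<open>\<Union>n. D n\<close> matter. A cube determines its level, and
  \<open>Q\<close> itself is never in \<open>G\<^sub>x\<close> for \<open>x > 1 / J Q\<close>, so it suffices to let the level range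
  over successors.
\<close>
definition G_set :: "(nat \<Rightarrow> 'a set set) \<Rightarrow> ('a set \<Rightarrow> real) \<Rightarrow> real \<Rightarrow> 'a set set" where
  "G_set D J x =
     {C. \<exists>n. C \<in> D (Suc n) \<and> J C < 1 / x \<and> (\<exists>C' \<in> D n. C \<subseteq> C' \<and> J C' \<ge> 1 / x)}"

text \<open>The cardinality is \<open>\<infinity>\<close> for an infinite set, unlike \<^const>\<open>card\<close>.\<close>
definition M_count :: "(nat \<Rightarrow> 'a set set) \<Rightarrow> ('a set \<Rightarrow> real) \<Rightarrow> real \<Rightarrow> ereal" where
  "M_count D J x =
     (if finite (G_set D J x) then ereal (real (card (G_set D J x))) else \<infinity>)"

definition upper_h :: "(nat \<Rightarrow> 'a set set) \<Rightarrow> ('a set \<Rightarrow> real) \<Rightarrow> ereal" where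
  "upper_h D J = Limsup at_top (\<lambda>x. eln (M_count D J x) / ereal (ln x))"

definition lower_h :: "(nat \<Rightarrow> 'a set set) \<Rightarrow> ('a set \<Rightarrow> real) \<Rightarrow> ereal" where
  "lower_h D J = Liminf at_top (\<lambda>x. eln (M_count D J x) / ereal (ln x))"

text \<open>The convention \<open>0\<^sup>0 = 0\<close> is that of \<^const>\<open>powr\<close>.\<close>
definition tau :: "(nat \<Rightarrow> 'a set set) \<Rightarrow> ('a set \<Rightarrow> real) \<Rightarrow> real \<Rightarrow> ereal" where
  "tau D J q =
     limsup (\<lambda>n. eln (ereal (\<Sum>C\<in>D n. J C powr q)) / ereal (ln (2 ^ n)))"

definition crit_q :: "(nat \<Rightarrow> 'a set set) \<Rightarrow> ('a set \<Rightarrow> real) \<Rightarrow> ereal" where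
  "crit_q D J = Inf {ereal q | q. q \<ge> 0 \<and> tau D J q < 0}"

definition dim_infty :: "(nat \<Rightarrow> 'a set set) \<Rightarrow> ('a set \<Rightarrow> real) \<Rightarrow> ereal" where
  "dim_infty D J = liminf (\<lambda>n. eln (ereal (Max (J ` D n))) / ereal (- ln (2 ^ n)))"

definition J_pow :: "'a measure \<Rightarrow> real \<Rightarrow> 'a set \<Rightarrow> real" where
  "J_pow \<nu> s C = measure \<nu> C powr s"

end

theory Submission
  imports Defs "HOL-Real_Asymp.Real_Asymp"
begin

text \<open>
  Write \<open>y = x powr (1/s)\<close>. A cube lies in \<open>G\<^sub>x\<close> for the set function \<open>\<nu>\<^sup>s\<close> iff its mass is below
  \<open>1/y\<close> while its parent has mass at least \<open>1/y\<close>, so it is enough to count these stopping cubes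
  for \<open>\<nu>\<close> itself and to show that there are \<open>y\<close> of them up to a constant and a logarithm.

  The hypothesis on \<open>dim_infty\<close> says that for some \<open>a > 0\<close> and all large \<open>n\<close> every cube of level
  \<open>n\<close> has mass at most \<open>2 powr (-a n)\<close>. Hence on descending from \<open>Q\<close> towards any point the mass
  eventually drops below \<open>1/y\<close>: the stopping cubes cover \<open>Q\<close>, and as each has mass
  below \<open>1/y\<close> there are at least \<open>y \<nu>(Q)\<close> of them (\<open>card_stopping_ge\<close>). Conversely the parent of a
  stopping cube has mass at least \<open>1/y\<close>, so it can only occur on the first \<open>O(log y)\<close> levels; by
  additivity every level carries at most \<open>y \<nu>(Q)\<close> such parents, and each has \<open>2^d\<close> children
  (\<open>card_stopping_le\<close>). Taking logarithms, both exponents \<open>h\<close> equal \<open>1/s\<close>.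

  For the critical exponent, compare the sum of \<open>\<nu>(C) powr p\<close>, \<open>p = s q\<close>, over a level with the
  sum of \<open>\<nu>(C)\<close>, which is \<open>\<nu>(Q)\<close> on every level. If \<open>p \<le> 1\<close> the power sum stays bounded away from
  \<open>0\<close>; if \<open>p > 1\<close> it picks up the factor \<open>2 powr (-a n (p-1))\<close>. So \<open>\<tau>(q) < 0\<close> iff \<open>q > 1/s\<close>.

  Geometry enters only through the tree structure and the measurability of the cubes, so the
  argument is carried out for an arbitrary tree of measurable partitions with constant branching number.
\<close>

section \<open>Trees of partitions with constant branching number\<close>

locale measured_partition_tree = finite_measure \<nu>
  for \<nu> :: "'a measure" +
  fixes Q :: "'a set" and D :: "nat \<Rightarrow> 'a set set" and b :: nat
  assumes root: "D 0 = {Q}"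
    and partition: "\<And>n. partition_on Q (D n)"
    and branching: "\<And>n C. C \<in> D n \<Longrightarrow> \<exists>S \<subseteq> D (Suc n). card S = b \<and> partition_on C S"
    and b_pos: "b > 0"
    and cell_measurable: "\<And>n C. C \<in> D n \<Longrightarrow> C \<in> sets \<nu>"
    and mass_pos: "measure \<nu> Q > 0"
begin

definition children :: "nat \<Rightarrow> 'a set \<Rightarrow> 'a set set" where
  "children n C = {E \<in> D (Suc n). E \<subseteq> C}"

lemma cell_nonempty: "C \<in> D n \<Longrightarrow> C \<noteq> {}"
  using partition_onD3[OF partition[of n]] by metis

lemma cell_eq:
  assumes "C \<in> D n" "E \<in> D n" "p \<in> C" "p \<in> E"
  shows "C = E"
  using partition_onD2[OF partition[of n]] assms unfolding disjoint_def by blast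

text \<open>
  The parts into which \<open>branching\<close> splits a cell are all cells of the next level inside it, since
  any other such cell would be disjoint from them, hence from \<open>C\<close>, and cells are nonempty.
\<close>
lemma
  assumes "C \<in> D n"
  shows card_children: "card (children n C) = b"
    and finite_children: "finite (children n C)"
    and Union_children: "\<Union> (children n C) = C"
proof -
  obtain S where S: "S \<subseteq> D (Suc n)" "card S = b" "partition_on C S"
    using branching[OF assms] by blast
  have "E \<in> S" if E: "E \<in> D (Suc n)" "E \<subseteq> C" for E
  proof -
    obtain p where p: "p \<in> E"
      using cell_nonempty[OF E(1)] by blast
    obtain E' where "E' \<in> S" "p \<in> E'"
      using partition_onD1[OF S(3)] p E(2) by blast
    then show ?thesis using cell_eq[of E "Suc n" E' p] S(1) p E(1) by blast
  qed
  then have "children n C = S"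
    using S(1) partition_onD1[OF S(3)] unfolding children_def by blast
  then show "card (children n C) = b" "finite (children n C)" "\<Union> (children n C) = C"
    using S partition_onD1[OF S(3)] b_pos by (auto intro: card_ge_0_finite)
qed

lemma parent_superset:
  assumes "C \<in> D n" "E \<in> D (Suc n)" "p \<in> C" "p \<in> E"
  shows "E \<subseteq> C"
proof -
  obtain E' where "E' \<in> children n C" "p \<in> E'"
    using Union_children[OF assms(1)] assms(3) by blast
  then show ?thesis using cell_eq[of E "Suc n" E' p] assms unfolding children_def by blast
qed

lemma level_subset_children: "D (Suc n) \<subseteq> (\<Union>C \<in> D n. children n C)"
proof
  fix E assume E: "E \<in> D (Suc n)"
  obtain p where p: "p \<in> E"
    using cell_nonempty[OF E] by blast
  then have "p \<in> \<Union> (D n)"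
    using E partition_onD1[OF partition[of n]] partition_onD1[OF partition[of "Suc n"]] by blast
  then obtain C where "C \<in> D n" "p \<in> C" by blast
  then show "E \<in> (\<Union>C \<in> D n. children n C)"
    using parent_superset[of C n E p] E p unfolding children_def by blast
qed

lemma finite_level: "finite (D n)"
proof (induction n)
  case 0
  then show ?case by (simp add: root)
next
  case (Suc n)
  then show ?case
    using finite_subset[OF level_subset_children] finite_children by blast
qed

lemma sum_level: "(\<Sum>C\<in>D n. measure \<nu> C) = measure \<nu> Q"
proof -
  have "disjoint_family_on (\<lambda>C. C) (D n)"
    using partition_onD2[OF partition[of n]]
    by (auto simp: disjoint_family_on_def disjoint_def)
  then have "measure \<nu> (\<Union>C\<in>D n. C) = (\<Sum>C\<in>D n. measure \<nu> C)"
    using cell_measurable by (intro finite_measure_finite_Union finite_level) auto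
  then show ?thesis using partition_onD1[OF partition[of n]] by simp
qed

lemma cell_le_root: "C \<in> D n \<Longrightarrow> measure \<nu> C \<le> measure \<nu> Q"
  using member_le_sum[of C "D n" "measure \<nu>"] finite_level sum_level by auto

section \<open>Counting stopping cells\<close>

text \<open>A Markov inequality for the counting measure on a level.\<close>
lemma card_heavy_le:
  assumes "y > 0"
  shows "real (card {C \<in> D n. 1 / y \<le> measure \<nu> C}) \<le> measure \<nu> Q * y"
proof -
  let ?H = "{C \<in> D n. 1 / y \<le> measure \<nu> C}"
  have "real (card ?H) * (1 / y) \<le> (\<Sum>C\<in>?H. measure \<nu> C)"
    by (rule sum_bounded_below) auto
  also have "\<dots> \<le> (\<Sum>C\<in>D n. measure \<nu> C)"
    by (rule sum_mono2) (auto simp: finite_level)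
  finally show ?thesis using assms by (simp add: sum_level field_simps)
qed

text \<open>
  Stopping cells are counted through their parents, which are heavy and therefore confined to the
  levels up to \<open>K\<close> when all deeper cells are light.
\<close>
lemma stopping_subset_children:
  assumes "\<And>n C. n > K \<Longrightarrow> C \<in> D n \<Longrightarrow> measure \<nu> C < 1 / y"
  shows "G_set D (measure \<nu>) y
           \<subseteq> (\<Union>n\<le>K. \<Union>C\<in>{C \<in> D n. 1 / y \<le> measure \<nu> C}. children n C)"
proof
  fix E assume "E \<in> G_set D (measure \<nu>) y"
  then obtain n C where nC: "E \<in> D (Suc n)" "C \<in> D n" "E \<subseteq> C" "1 / y \<le> measure \<nu> C"
    unfolding G_set_def by blast
  then have "n \<le> K" using assms[of n C] by (meson not_le)
  then show "E \<in> (\<Union>n\<le>K. \<Union>C\<in>{C \<in> D n. 1 / y \<le> measure \<nu> C}. children n C)"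
    using nC unfolding children_def by blast
qed

lemma
  assumes "y > 0"
    and light: "\<And>n C. n > K \<Longrightarrow> C \<in> D n \<Longrightarrow> measure \<nu> C < 1 / y"
  shows finite_stopping: "finite (G_set D (measure \<nu>) y)"
    and card_stopping_le:
      "real (card (G_set D (measure \<nu>) y)) \<le> real b * measure \<nu> Q * y * (real K + 1)"
proof -
  let ?H = "\<lambda>n. {C \<in> D n. 1 / y \<le> measure \<nu> C}"
  let ?U = "\<Union>n\<le>K. \<Union>C\<in>?H n. children n C"
  have fin: "finite ?U" using finite_level finite_children by auto
  have sub: "G_set D (measure \<nu>) y \<subseteq> ?U"
    by (rule stopping_subset_children[OF light])
  show "finite (G_set D (measure \<nu>) y)"
    by (rule finite_subset[OF sub fin])
  have level: "real (card (\<Union>C\<in>?H n. children n C)) \<le> real b * measure \<nu> Q * y" for n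
  proof -
    have "card (\<Union>C\<in>?H n. children n C) \<le> (\<Sum>C\<in>?H n. card (children n C))"
      by (rule card_UN_le) (simp add: finite_level)
    also have "\<dots> = b * card (?H n)" by (simp add: card_children)
    finally have "real (card (\<Union>C\<in>?H n. children n C)) \<le> real (b * card (?H n))"
      by (rule of_nat_mono)
    also have "\<dots> = real b * real (card (?H n))" by (rule of_nat_mult)
    also have "\<dots> \<le> real b * (measure \<nu> Q * y)"
      by (intro mult_left_mono card_heavy_le assms(1)) simp
    finally show ?thesis by (simp add: mult.assoc)
  qed
  have "card (G_set D (measure \<nu>) y) \<le> card ?U"
    by (rule card_mono[OF fin sub])
  also have "\<dots> \<le> (\<Sum>n\<le>K. card (\<Union>C\<in>?H n. children n C))"
    by (rule card_UN_le) simp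
  finally have "real (card (G_set D (measure \<nu>) y))
      \<le> real (\<Sum>n\<le>K. card (\<Union>C\<in>?H n. children n C))"
    by (rule of_nat_mono)
  also have "\<dots> = (\<Sum>n\<le>K. real (card (\<Union>C\<in>?H n. children n C)))"
    by (rule of_nat_sum)
  also have "\<dots> \<le> real (card {..K}) * (real b * measure \<nu> Q * y)"
    by (rule sum_bounded_above) (rule level)
  finally show "real (card (G_set D (measure \<nu>) y)) \<le> real b * measure \<nu> Q * y * (real K + 1)"
    by (simp add: algebra_simps)
qed

text \<open>
  Follow the cells around a point down from the root, which is heavy: the first light cell on this
  path is a stopping cell.
\<close>
lemma root_subset_stopping:
  assumes heavy_root: "1 / y \<le> measure \<nu> Q"
    and light: "\<And>C. C \<in> D m \<Longrightarrow> measure \<nu> C < 1 / y"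
  shows "Q \<subseteq> \<Union> (G_set D (measure \<nu>) y)"
proof
  fix p assume p: "p \<in> Q"
  have "\<exists>C\<in>D n. p \<in> C" for n
    using p partition_onD1[OF partition[of n]] by blast
  then obtain c where c: "\<And>n. c n \<in> D n" "\<And>n. p \<in> c n" by metis
  define k where "k = (LEAST k. measure \<nu> (c k) < 1 / y)"
  have k: "measure \<nu> (c k) < 1 / y"
    unfolding k_def by (rule LeastI[of _ m]) (rule light[OF c(1)])
  have "k \<noteq> 0" using k heavy_root c(1)[of 0] by (cases k) (auto simp: root)
  then obtain j where j: "k = Suc j" using not0_implies_Suc by blast
  then have "1 / y \<le> measure \<nu> (c j)"
    using not_less_Least[of j "\<lambda>k. measure \<nu> (c k) < 1 / y"] by (simp add: k_def[symmetric])
  moreover have "c k \<subseteq> c j" using parent_superset[of "c j" j "c k" p] c j by metis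
  ultimately have "c k \<in> G_set D (measure \<nu>) y"
    using k c(1)[of k] c(1)[of j] j unfolding G_set_def by blast
  then show "p \<in> \<Union> (G_set D (measure \<nu>) y)" using c(2)[of k] by blast
qed

text \<open>
  The stopping cells cover \<open>Q\<close> and each is lighter than \<open>1 / y\<close>, so subadditivity yields the lower
  bound. Finiteness of the family comes from the upper count.
\<close>
lemma card_stopping_ge:
  assumes "y > 0" and heavy_root: "1 / y \<le> measure \<nu> Q"
    and light: "\<And>n C. n > K \<Longrightarrow> C \<in> D n \<Longrightarrow> measure \<nu> C < 1 / y"
  shows "measure \<nu> Q * y \<le> real (card (G_set D (measure \<nu>) y))"
proof -
  let ?G = "G_set D (measure \<nu>) y"
  have fin: "finite ?G" by (rule finite_stopping[OF assms(1) light])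
  have meas: "C \<in> sets \<nu>" if "C \<in> ?G" for C
    using that cell_measurable unfolding G_set_def by blast
  have "measure \<nu> Q \<le> measure \<nu> (\<Union>C\<in>?G. C)"
    using root_subset_stopping[OF heavy_root, of "Suc K"] light[of "Suc K"] fin meas
    by (intro finite_measure_mono sets.finite_UN) auto
  also have "\<dots> \<le> (\<Sum>C\<in>?G. measure \<nu> C)"
    using meas fin by (intro finite_measure_subadditive_finite) auto
  also have "\<dots> \<le> real (card ?G) * (1 / y)"
    by (rule sum_bounded_above) (auto simp: G_set_def)
  finally show ?thesis using assms(1) by (simp add: field_simps)
qed

section \<open>Power functions of the measure\<close>

text \<open>
  Replacing \<open>\<nu>\<close> by \<open>\<nu>\<^sup>s\<close> only rescales the threshold, so counting for \<open>\<nu>\<close> suffices.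
\<close>
lemma J_pow_less_iff:
  assumes "s > 0" "x > 0"
  shows "J_pow \<nu> s C < 1 / x \<longleftrightarrow> measure \<nu> C < 1 / x powr (1 / s)"
proof -
  have "1 / x = (1 / x powr (1 / s)) powr s"
    using assms by (simp add: powr_divide powr_powr)
  then show ?thesis
    unfolding J_pow_def
    using assms powr_less_mono2[of s "measure \<nu> C" "1 / x powr (1 / s)"]
      powr_mono2[of s "1 / x powr (1 / s)" "measure \<nu> C"]
    by (smt (verit) measure_nonneg zero_le_divide_1_iff powr_ge_zero)
qed

lemma G_set_J_pow:
  assumes "s > 0" "x > 0"
  shows "G_set D (J_pow \<nu> s) x = G_set D (measure \<nu>) (x powr (1 / s))"
  using J_pow_less_iff[OF assms] unfolding G_set_def by (simp add: not_less[symmetric])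

section \<open>Decay of the masses and the counting exponents\<close>

definition decay :: "real \<Rightarrow> nat \<Rightarrow> bool" where
  "decay a N \<longleftrightarrow> a > 0 \<and> (\<forall>n\<ge>N. \<forall>C\<in>D n. measure \<nu> C \<le> 2 powr (- a * real n))"

text \<open>
  Any \<open>a\<close> strictly between \<open>0\<close> and \<open>dim_infty\<close> is a decay rate. Cells of mass zero are handled
  separately because \<open>ln\<close> turns into an inequality for masses only when the maximum is positive.
\<close>
lemma ex_decay:
  assumes "dim_infty D (J_pow \<nu> 1) > 0"
  shows "\<exists>a N. decay a N"
proof -
  let ?m = "\<lambda>n. Max (measure \<nu> ` D n)"
  have J1: "J_pow \<nu> 1 = measure \<nu>" by (auto simp: J_pow_def fun_eq_iff)
  obtain a where a: "0 < ereal a" "ereal a < dim_infty D (J_pow \<nu> 1)"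
    using ereal_dense2[OF assms] by blast
  have "\<forall>\<^sub>F n in sequentially. ereal a < eln (ereal (?m n)) / ereal (- ln (2 ^ n))"
    using less_LiminfD[OF a(2)[unfolded dim_infty_def J1]] .
  moreover have "\<forall>\<^sub>F n in sequentially. n > (0::nat)" by (rule eventually_gt_at_top)
  ultimately have "\<forall>\<^sub>F n in sequentially. \<forall>C\<in>D n. measure \<nu> C \<le> 2 powr (- a * real n)"
  proof eventually_elim
    case (elim n)
    have "measure \<nu> C \<le> 2 powr (- a * real n)" if C: "C \<in> D n" for C
    proof (cases "measure \<nu> C = 0")
      case False
      have le: "measure \<nu> C \<le> ?m n" using C finite_level by simp
      then have pos: "?m n > 0" using False by (smt (verit) measure_nonneg)
      have ln2: "ln ((2::real) ^ n) > 0" using elim(2) by simp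
      then have "a < ln (?m n) / (- ln (2 ^ n))"
        using elim(1) pos
        by (simp add: eln_def less_imp_neq[symmetric] del: ln_eq_zero_iff ln_gt_zero_iff)
      with ln2 have "ln (?m n) < - a * ln (2 ^ n)"
        by (simp add: field_simps)
      also have "\<dots> = - a * real n * ln 2" by (simp add: ln_realpow)
      finally have "?m n < 2 powr (- a * real n)"
        using pos by (metis exp_less_cancel_iff exp_ln powr_def zero_neq_numeral)
      then show ?thesis using le by simp
    qed simp
    then show ?case by blast
  qed
  then show ?thesis using a(1) unfolding decay_def eventually_sequentially by auto
qed

text \<open>
  The bound on the level is linear in \<open>ln y\<close> because \<open>2 powr (-a n) < 1 / y\<close> means
  \<open>n > ln y / (a ln 2)\<close>; the summand \<open>N\<close> reaches the range where the decay holds. Only these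
  logarithmically many levels contribute to the count, so they do not affect its exponent.
\<close>
lemma decay_light:
  assumes "decay a N" "y \<ge> 1" "n > N + nat \<lfloor>ln y / (a * ln 2)\<rfloor>" "C \<in> D n"
  shows "measure \<nu> C < 1 / y"
proof -
  have a: "a > 0" using assms(1) by (simp add: decay_def)
  have "real n > ln y / (a * ln 2)" using assms(3) by linarith
  then have "- a * real n * ln 2 < - ln y" using a by (simp add: field_simps)
  then have "2 powr (- a * real n) < exp (- ln y)" by (simp add: powr_def)
  also have "\<dots> = 1 / y" using assms(2) by (simp add: exp_minus field_simps)
  finally show ?thesis using assms(1,3,4) unfolding decay_def
    by (meson add_leE le_less_trans less_imp_le)
qed

text \<open>
  The two counting bounds at \<open>y = x powr (1/s)\<close> enclose \<open>ln M(x) / ln x\<close>. Constants and the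
  logarithmic factor vanish after division by \<open>ln x\<close>, which gives a genuine limit and
  hence the lower and the upper exponent at once.
\<close>
lemma counting_exponent:
  assumes "decay a N" "s > 0"
  shows "((\<lambda>x. eln (M_count D (J_pow \<nu> s) x) / ereal (ln x)) \<longlongrightarrow> ereal (1 / s)) at_top"
proof -
  define B where "B = real b * measure \<nu> Q"
  define c where "c = 1 / (s * a * ln 2)"
  define M where "M = (\<lambda>x. real (card (G_set D (J_pow \<nu> s) x)))"
  have "a > 0" using assms(1) by (simp add: decay_def)
  then have pos: "B > 0" "c > 0" "measure \<nu> Q > 0"
    using b_pos mass_pos assms(2) by (auto simp: B_def c_def)
  have "filterlim (\<lambda>x::real. x powr (1 / s)) at_top at_top"
    using assms(2) by real_asymp
  then have "\<forall>\<^sub>F x in at_top. x powr (1 / s) \<ge> 1 / measure \<nu> Q"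
    by (simp add: filterlim_at_top)
  then have bounds: "\<forall>\<^sub>F x in at_top. x > 1 \<and> finite (G_set D (J_pow \<nu> s) x) \<and>
      measure \<nu> Q * x powr (1 / s) \<le> M x \<and>
      M x \<le> B * x powr (1 / s) * (real N + 1 + c * ln x)"
    using eventually_gt_at_top[of "1::real"]
  proof eventually_elim
    case (elim x)
    let ?y = "x powr (1 / s)"
    let ?K = "N + nat \<lfloor>ln ?y / (a * ln 2)\<rfloor>"
    have y: "?y \<ge> 1" using elim(2) assms(2) by (simp add: ge_one_powr_ge_zero)
    then have y0: "?y > 0" by linarith
    note light = decay_light[OF assms(1) y]
    have G: "G_set D (J_pow \<nu> s) x = G_set D (measure \<nu>) ?y"
      using elim(2) by (intro G_set_J_pow assms(2)) simp
    have heavy_root: "1 / ?y \<le> measure \<nu> Q" using elim(1) y0 pos(3) by (simp add: field_simps)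
    have ge: "measure \<nu> Q * ?y \<le> M x"
      unfolding M_def G by (rule card_stopping_ge[OF y0 heavy_root light])
    have lny: "ln ?y / (a * ln 2) = c * ln x"
      using elim(2) by (simp add: ln_powr c_def)
    have "real ?K \<le> real N + c * ln x"
      unfolding lny using pos(2) elim(2) by simp
    then have "B * ?y * (real ?K + 1) \<le> B * ?y * (real N + 1 + c * ln x)"
      using pos(1) y0 by (intro mult_left_mono) auto
    moreover have "M x \<le> B * ?y * (real ?K + 1)"
      unfolding M_def G B_def by (rule card_stopping_le[OF y0 light])
    ultimately show ?case
      using ge elim(2) finite_stopping[OF y0 light] unfolding G by fastforce
  qed
  have "((\<lambda>x. ln (M x) / ln x) \<longlongrightarrow> 1 / s) at_top"
  proof (rule tendsto_sandwich)
    show "\<forall>\<^sub>F x in at_top. ln (measure \<nu> Q * x powr (1 / s)) / ln x \<le> ln (M x) / ln x"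
      using bounds
    proof eventually_elim
      case (elim x)
      then have "measure \<nu> Q * x powr (1 / s) > 0" using pos by simp
      then show ?case using elim by (intro divide_right_mono) auto
    qed
    show "\<forall>\<^sub>F x in at_top.
        ln (M x) / ln x \<le> ln (B * x powr (1 / s) * (real N + 1 + c * ln x)) / ln x"
      using bounds
    proof eventually_elim
      case (elim x)
      then have "measure \<nu> Q * x powr (1 / s) > 0" using pos by simp
      then show ?case using elim by (intro divide_right_mono) auto
    qed
    show "((\<lambda>x. ln (measure \<nu> Q * x powr (1 / s)) / ln x) \<longlongrightarrow> 1 / s) at_top"
      using pos assms(2) by real_asymp
    show "((\<lambda>x. ln (B * x powr (1 / s) * (real N + 1 + c * ln x)) / ln x) \<longlongrightarrow> 1 / s) at_top"
      using pos assms(2) by real_asymp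
  qed
  then have "((\<lambda>x. ereal (ln (M x) / ln x)) \<longlongrightarrow> ereal (1 / s)) at_top"
    by simp
  moreover have "\<forall>\<^sub>F x in at_top.
      ereal (ln (M x) / ln x) = eln (M_count D (J_pow \<nu> s) x) / ereal (ln x)"
    using bounds
  proof eventually_elim
    case (elim x)
    then have "measure \<nu> Q * x powr (1 / s) > 0" using pos by simp
    then have "M x > 0" using elim by linarith
    moreover have "ereal (ln x) \<noteq> 0" "M_count D (J_pow \<nu> s) x = ereal (M x)"
      using elim by (simp_all add: M_count_def M_def)
    ultimately show ?case using elim by (simp add: eln_def)
  qed
  ultimately show ?thesis by (rule Lim_transform_eventually)
qed

section \<open>The critical exponent\<close>

text \<open>
  Both estimates of a power sum factor \<open>\<nu>(C) powr p\<close> as \<open>\<nu>(C) * \<nu>(C) powr (p - 1)\<close>, bound the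
  second factor uniformly on the level, and use that the masses sum to \<open>\<nu>(Q)\<close>. For \<open>p \<le> 1\<close> the
  second factor is smallest at the largest possible mass. Null cells are treated apart, since on
  them \<open>powr\<close> is not monotone for negative exponents.
\<close>
lemma sum_powr_ge:
  assumes "p \<le> 1"
  shows "measure \<nu> Q powr p \<le> (\<Sum>C\<in>D n. measure \<nu> C powr p)"
proof -
  have "measure \<nu> C * measure \<nu> Q powr (p - 1) \<le> measure \<nu> C powr p" if "C \<in> D n" for C
  proof (cases "measure \<nu> C = 0")
    case False
    then have C: "measure \<nu> C > 0" by (simp add: zero_less_measure_iff)
    have "measure \<nu> Q powr (p - 1) \<le> measure \<nu> C powr (p - 1)"
      using C cell_le_root[OF that] assms by (intro powr_mono2') auto
    then have "measure \<nu> C * measure \<nu> Q powr (p - 1) \<le> measure \<nu> C * measure \<nu> C powr (p - 1)"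
      by (intro mult_left_mono) auto
    then show ?thesis using C by (simp add: powr_mult_base)
  qed simp
  then have "(\<Sum>C\<in>D n. measure \<nu> C * measure \<nu> Q powr (p - 1))
      \<le> (\<Sum>C\<in>D n. measure \<nu> C powr p)"
    by (rule sum_mono)
  then show ?thesis
    using mass_pos by (simp add: sum_distrib_right[symmetric] sum_level powr_mult_base)
qed

lemma sum_powr_le:
  assumes "p \<ge> 1" "\<And>C. C \<in> D n \<Longrightarrow> measure \<nu> C \<le> u"
  shows "(\<Sum>C\<in>D n. measure \<nu> C powr p) \<le> measure \<nu> Q * u powr (p - 1)"
proof -
  have "measure \<nu> C powr p \<le> measure \<nu> C * u powr (p - 1)" if "C \<in> D n" for C
  proof -
    have "measure \<nu> C powr p = measure \<nu> C * measure \<nu> C powr (p - 1)"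
      by (simp add: powr_mult_base)
    then show ?thesis
      using assms(1) assms(2)[OF that] by (simp add: mult_left_mono powr_mono2)
  qed
  then have "(\<Sum>C\<in>D n. measure \<nu> C powr p) \<le> (\<Sum>C\<in>D n. measure \<nu> C * u powr (p - 1))"
    by (rule sum_mono)
  then show ?thesis by (simp add: sum_distrib_right[symmetric] sum_level)
qed

lemma tau_nonneg:
  assumes "s * q \<le> 1"
  shows "tau D (J_pow \<nu> s) q \<ge> 0"
proof -
  define S where "S = (\<lambda>n. \<Sum>C\<in>D n. J_pow \<nu> s C powr q)"
  define k where "k = measure \<nu> Q powr (s * q)"
  have k: "k > 0" using mass_pos by (simp add: k_def)
  have S: "k \<le> S n" for n
    using sum_powr_ge[OF assms, of n] by (simp add: S_def k_def J_pow_def powr_powr)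
  have "(\<lambda>n. ln k / ln (2 ^ n)) \<longlonglongrightarrow> 0" using k by real_asymp
  then have "(\<lambda>n. ereal (ln k / ln (2 ^ n))) \<longlonglongrightarrow> ereal 0" by simp
  then have "limsup (\<lambda>n. ereal (ln k / ln (2 ^ n))) = ereal 0"
    by (rule lim_imp_Limsup[OF sequentially_bot])
  moreover have "\<forall>\<^sub>F n in sequentially.
      ereal (ln k / ln (2 ^ n)) \<le> eln (ereal (S n)) / ereal (ln (2 ^ n))"
    using eventually_gt_at_top[of "0::nat"]
  proof eventually_elim
    case (elim n)
    then have "ln ((2::real) ^ n) > 0" by simp
    moreover have "ln k \<le> ln (S n)" "S n > 0" using k S[of n] by auto
    ultimately show ?case by (simp add: eln_def divide_right_mono)
  qed
  then have "limsup (\<lambda>n. ereal (ln k / ln (2 ^ n)))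
      \<le> limsup (\<lambda>n. eln (ereal (S n)) / ereal (ln (2 ^ n)))"
    by (rule Limsup_mono)
  ultimately show ?thesis by (simp add: tau_def S_def zero_ereal_def)
qed

lemma tau_neg:
  assumes "decay a N" "s * q > 1"
  shows "tau D (J_pow \<nu> s) q < 0"
proof -
  define S where "S = (\<lambda>n. \<Sum>C\<in>D n. J_pow \<nu> s C powr q)"
  define r where "r = a * (s * q - 1)"
  define f where "f = (\<lambda>n::nat. measure \<nu> Q * 2 powr (- r * real n))"
  have r: "r > 0" using assms by (simp add: r_def decay_def)
  have Sf: "S n \<le> f n" if "n \<ge> N" for n
  proof -
    have "S n \<le> measure \<nu> Q * (2 powr (- a * real n)) powr (s * q - 1)"
      using sum_powr_le[of "s * q" n "2 powr (- a * real n)"] assms that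
      by (simp add: S_def J_pow_def powr_powr decay_def)
    then show ?thesis by (simp add: f_def r_def powr_powr algebra_simps)
  qed
  have "(\<lambda>n. ln (f n) / ln (2 ^ n)) \<longlonglongrightarrow> - r"
    unfolding f_def using mass_pos r by real_asymp
  then have "(\<lambda>n. ereal (ln (f n) / ln (2 ^ n))) \<longlonglongrightarrow> ereal (- r)" by simp
  then have "limsup (\<lambda>n. ereal (ln (f n) / ln (2 ^ n))) = ereal (- r)"
    by (rule lim_imp_Limsup[OF sequentially_bot])
  moreover have "\<forall>\<^sub>F n in sequentially.
      eln (ereal (S n)) / ereal (ln (2 ^ n)) \<le> ereal (ln (f n) / ln (2 ^ n))"
    using eventually_gt_at_top[of "0::nat"] eventually_ge_at_top[of N]
  proof eventually_elim
    case (elim n)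
    then have "ln ((2::real) ^ n) > 0" by simp
    moreover have "S n > 0 \<Longrightarrow> ln (S n) \<le> ln (f n)" using Sf[OF elim(2)] by simp
    ultimately show ?case by (cases "S n > 0") (simp_all add: eln_def divide_right_mono)
  qed
  then have "limsup (\<lambda>n. eln (ereal (S n)) / ereal (ln (2 ^ n)))
      \<le> limsup (\<lambda>n. ereal (ln (f n) / ln (2 ^ n)))"
    by (rule Limsup_mono)
  ultimately have "tau D (J_pow \<nu> s) q \<le> ereal (- r)" by (simp add: tau_def S_def)
  also have "\<dots> < 0" using r by simp
  finally show ?thesis .
qed

lemma crit_q_J_pow:
  assumes "decay a N" "s > 0"
  shows "crit_q D (J_pow \<nu> s) = ereal (1 / s)"
proof -
  have neg_iff: "tau D (J_pow \<nu> s) q < 0 \<longleftrightarrow> 1 / s < q" for q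
    using tau_nonneg[of s q] tau_neg[OF assms(1), of s q] assms(2)
    by (cases "s * q \<le> 1") (auto simp: field_simps not_le)
  have "q \<ge> 0" if "1 / s < q" for q
    using that assms(2) by (smt (verit) divide_nonneg_pos)
  then have "{ereal q |q. q \<ge> 0 \<and> tau D (J_pow \<nu> s) q < 0} = ereal ` {1 / s<..}"
    unfolding neg_iff by auto
  moreover have "Inf (ereal ` {1 / s<..}) = ereal (1 / s)"
  proof (rule antisym)
    show "ereal (1 / s) \<le> Inf (ereal ` {1 / s<..})"
      by (rule Inf_greatest) auto
    show "Inf (ereal ` {1 / s<..}) \<le> ereal (1 / s)"
    proof (rule ereal_le_epsilon2)
      fix e :: real assume "0 < e"
      then show "Inf (ereal ` {1 / s<..}) \<le> ereal (1 / s) + ereal e"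
        by (intro Inf_lower) auto
    qed
  qed
  ultimately show ?thesis by (simp add: crit_q_def)
qed

end

section \<open>Dyadic cubes\<close>

lemma dyadic_cube_borel:
  assumes "dyadic_cube n C"
  shows "C \<in> sets borel"
proof -
  obtain I where I: "\<And>i. dyadic_interval n (I i)" "C = {x. \<forall>i. x $ i \<in> I i}"
    using assms unfolding dyadic_cube_def by blast
  have "I i \<in> sets borel" for i
    using I(1)[of i] by (auto simp: dyadic_interval_def Let_def)
  then have "{x \<in> space borel. x $ i \<in> I i} \<in> sets borel" for i
    by measurable
  then have "(\<Inter>i. {x \<in> space borel. x $ i \<in> I i}) \<in> sets borel"
    by (intro sets.finite_INT) auto
  also have "(\<Inter>i. {x \<in> space borel. x $ i \<in> I i}) = C"
    using I(2) by auto
  finally show ?thesis .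
qed

lemma dyadic_measured_partition_tree:
  fixes Q :: "(real ^ 'd) set" and \<nu> :: "(real ^ 'd) measure"
  assumes "dyadic_partitions Q D" "sets \<nu> = sets (restrict_space borel Q)"
    "finite_measure \<nu>" "measure \<nu> Q > 0"
  shows "measured_partition_tree \<nu> Q D (2 ^ CARD('d))"
proof (intro measured_partition_tree.intro measured_partition_tree_axioms.intro)
  have Q: "Q \<in> sets borel"
    using assms(1) dyadic_cube_borel unfolding dyadic_partitions_def by blast
  show "C \<in> sets \<nu>" if C: "C \<in> D n" for n C
  proof -
    have cubes: "partition_on Q (D n)" "\<forall>C \<in> D n. dyadic_cube n C"
      using assms(1) unfolding dyadic_partitions_def by blast+
    have "C \<in> sets borel" using cubes(2) C dyadic_cube_borel by blast
    moreover have "C \<subseteq> Q" using partition_onD1[OF cubes(1)] C by blast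
    ultimately show ?thesis using Q by (simp add: assms(2) sets_restrict_space_iff)
  qed
qed (use assms in \<open>auto simp: dyadic_partitions_def\<close>)

theorem corollary1p6:
  fixes Q :: "(real ^ 'd) set"
    and D :: "nat \<Rightarrow> (real ^ 'd) set set"
    and \<nu> :: "(real ^ 'd) measure"
  assumes "dyadic_partitions Q D"
    and "sets \<nu> = sets (restrict_space borel Q)"
    and "finite_measure \<nu>"
    and "measure \<nu> Q > 0"
    and "dim_infty D (J_pow \<nu> 1) > 0"
  shows "\<forall>s>0. lower_h D (J_pow \<nu> s) = ereal (1 / s) \<and>
               upper_h D (J_pow \<nu> s) = ereal (1 / s) \<and>
               crit_q D (J_pow \<nu> s) = ereal (1 / s)"
proof -
  interpret measured_partition_tree \<nu> Q D "2 ^ CARD('d)"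
    by (rule dyadic_measured_partition_tree[OF assms(1-4)])
  obtain a N where decay: "decay a N" using ex_decay[OF assms(5)] by blast
  show ?thesis
    unfolding lower_h_def upper_h_def
    using lim_imp_Liminf[OF _ counting_exponent[OF decay]]
      lim_imp_Limsup[OF _ counting_exponent[OF decay]] crit_q_J_pow[OF decay]
    by simp
qed

end
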